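(* Given integers $a_1,\dots,a_n \geq 1$ such that $a_{i+1}/a_i$ is an integer for all $i<n$, and integer intervals $R_1,\dots,R_n$, such that the instance is feasible (some integer $s\ge 0$ satisfies: for every $i$ there exists $r_i\in R_i$ with $s\equiv r_i\pmod{a_i}$), the smallest such $s$, denoted $s_{\min}$, can be computed in time $\mathcal{O}(n^3)$.
   Context: Fuzzy Simultaneous Congruences with harmonic divisors; running time counts arithmetic operations on the input numbers (strongly polynomial). *)

theory Defs
  imports
    Complex_Main
    "HOL-Library.Log_Nat"
    "HOL-Library.Landau_Symbols"
    "HOL-Computational_Algebra.Polynomial"
    "HOL-Number_Theory.Cong"
begin

text \<open>Instances are indexed by \<open>1..n\<close>; values outside this range are irrelevant.\<close>

definition fsc_solution :: "nat \<Rightarrow> (nat \<Rightarrow> int) \<Rightarrow> (nat \<Rightarrow> int set) \<Rightarrow> nat \<Rightarrow> bool" where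
  "fsc_solution n a R s \<longleftrightarrow> (\<forall>i\<in>{1..n}. \<exists>r\<in>R i. [int s = r] (mod a i))"

definition fsc_feasible :: "nat \<Rightarrow> (nat \<Rightarrow> int) \<Rightarrow> (nat \<Rightarrow> int set) \<Rightarrow> bool" where
  "fsc_feasible n a R \<longleftrightarrow> (\<exists>s. fsc_solution n a R s)"

definition s_min :: "nat \<Rightarrow> (nat \<Rightarrow> int) \<Rightarrow> (nat \<Rightarrow> int set) \<Rightarrow> nat" where
  "s_min n a R = (LEAST s. fsc_solution n a R s)"

definition harmonic_divisors :: "nat \<Rightarrow> (nat \<Rightarrow> int) \<Rightarrow> bool" where
  "harmonic_divisors n a \<longleftrightarrow> (\<forall>i\<in>{1..n}. a i \<ge> 1) \<and> (\<forall>i\<in>{1..<n}. a i dvd a (Suc i))"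


text \<open>
  The machine model is a while language over integer variables and integer arrays. A program is
  a finite syntactic object, so it cannot depend on the instance; in particular, it uses
  finitely many constants and variables, and any number of integers that grows with the instance
  has to be kept in arrays.
\<close>

type_synonym vname = string

text \<open>\<open>Div\<close> is floor division and \<open>Mod\<close> its remainder; both are total, as in HOL.\<close>

datatype aop = Add | Sub | Mul | Div | Mod

datatype aexp =
    N int
  | V vname
  | Elem vname aexp
  | Bin aop aexp aexp

datatype bexp =
    Less aexp aexp
  | Equal aexp aexp
  | Not bexp
  | And bexp bexp

datatype com =
    Skip
  | Assign vname aexp
  | Store vname aexp aexp  \<comment> \<open>array name, index, value\<close>
  | Seq com com
  | Cond bexp com com
  | While bexp com

record state =
  vars :: "vname \<Rightarrow> int"
  arrs :: "vname \<Rightarrow> int \<Rightarrow> int"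

fun aop_val :: "aop \<Rightarrow> int \<Rightarrow> int \<Rightarrow> int" where
  "aop_val Add x y = x + y"
| "aop_val Sub x y = x - y"
| "aop_val Mul x y = x * y"
| "aop_val Div x y = x div y"
| "aop_val Mod x y = x mod y"

fun aval :: "aexp \<Rightarrow> state \<Rightarrow> int" where
  "aval (N k) \<sigma> = k"
| "aval (V x) \<sigma> = vars \<sigma> x"
| "aval (Elem x e) \<sigma> = arrs \<sigma> x (aval e \<sigma>)"
| "aval (Bin f d e) \<sigma> = aop_val f (aval d \<sigma>) (aval e \<sigma>)"

fun bval :: "bexp \<Rightarrow> state \<Rightarrow> bool" where
  "bval (Less d e) \<sigma> \<longleftrightarrow> aval d \<sigma> < aval e \<sigma>"
| "bval (Equal d e) \<sigma> \<longleftrightarrow> aval d \<sigma> = aval e \<sigma>"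
| "bval (Not b) \<sigma> \<longleftrightarrow> \<not> bval b \<sigma>"
| "bval (And b c) \<sigma> \<longleftrightarrow> bval b \<sigma> \<and> bval c \<sigma>"

text \<open>
  Two resources are measured. Time charges one unit for every constant, access, arithmetic
  operation, comparison, connective and command, independently of the size of the operands.
  Width is the largest bit length (sign bit included) among all integers that are
  read or computed, intermediate results and array indices included.
\<close>

definition bit_size :: "int \<Rightarrow> nat" where
  "bit_size z = floorlog 2 (nat \<bar>z\<bar>) + 1"

fun atime :: "aexp \<Rightarrow> nat" where
  "atime (N k) = 1"
| "atime (V x) = 1"
| "atime (Elem x e) = 1 + atime e"
| "atime (Bin f d e) = 1 + atime d + atime e"

fun btime :: "bexp \<Rightarrow> nat" where
  "btime (Less d e) = 1 + atime d + atime e"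
| "btime (Equal d e) = 1 + atime d + atime e"
| "btime (Not b) = 1 + btime b"
| "btime (And b c) = 1 + btime b + btime c"

fun awidth :: "aexp \<Rightarrow> state \<Rightarrow> nat" where
  "awidth (N k) \<sigma> = bit_size k"
| "awidth (V x) \<sigma> = bit_size (vars \<sigma> x)"
| "awidth (Elem x e) \<sigma> = max (awidth e \<sigma>) (bit_size (aval (Elem x e) \<sigma>))"
| "awidth (Bin f d e) \<sigma> =
     max (max (awidth d \<sigma>) (awidth e \<sigma>)) (bit_size (aval (Bin f d e) \<sigma>))"

fun bwidth :: "bexp \<Rightarrow> state \<Rightarrow> nat" where
  "bwidth (Less d e) \<sigma> = max (awidth d \<sigma>) (awidth e \<sigma>)"
| "bwidth (Equal d e) \<sigma> = max (awidth d \<sigma>) (awidth e \<sigma>)"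
| "bwidth (Not b) \<sigma> = bwidth b \<sigma>"
| "bwidth (And b c) \<sigma> = max (bwidth b \<sigma>) (bwidth c \<sigma>)"

text \<open>
  \<open>exec c \<sigma> t w \<tau>\<close>: started in state \<open>\<sigma>\<close>, the program \<open>c\<close> terminates in state \<open>\<tau>\<close>
  after time \<open>t\<close> with width \<open>w\<close>.
\<close>

inductive exec :: "com \<Rightarrow> state \<Rightarrow> nat \<Rightarrow> nat \<Rightarrow> state \<Rightarrow> bool" where
  Skip: "exec Skip \<sigma> 1 0 \<sigma>"
| Assign: "exec (Assign x e) \<sigma> (1 + atime e) (awidth e \<sigma>)
     (\<sigma>\<lparr>vars := (vars \<sigma>)(x := aval e \<sigma>)\<rparr>)"
| Store: "exec (Store x d e) \<sigma> (1 + atime d + atime e) (max (awidth d \<sigma>) (awidth e \<sigma>))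
     (\<sigma>\<lparr>arrs := (arrs \<sigma>)(x := (arrs \<sigma> x)(aval d \<sigma> := aval e \<sigma>))\<rparr>)"
| Seq: "exec c1 \<sigma> t1 w1 \<rho> \<Longrightarrow> exec c2 \<rho> t2 w2 \<tau> \<Longrightarrow>
     exec (Seq c1 c2) \<sigma> (1 + t1 + t2) (max w1 w2) \<tau>"
| CondTrue: "bval b \<sigma> \<Longrightarrow> exec c1 \<sigma> t w \<tau> \<Longrightarrow>
     exec (Cond b c1 c2) \<sigma> (1 + btime b + t) (max (bwidth b \<sigma>) w) \<tau>"
| CondFalse: "\<not> bval b \<sigma> \<Longrightarrow> exec c2 \<sigma> t w \<tau> \<Longrightarrow>
     exec (Cond b c1 c2) \<sigma> (1 + btime b + t) (max (bwidth b \<sigma>) w) \<tau>"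
| WhileFalse: "\<not> bval b \<sigma> \<Longrightarrow> exec (While b c) \<sigma> (1 + btime b) (bwidth b \<sigma>) \<sigma>"
| WhileTrue: "bval b \<sigma> \<Longrightarrow> exec c \<sigma> t1 w1 \<rho> \<Longrightarrow> exec (While b c) \<rho> t2 w2 \<tau> \<Longrightarrow>
     exec (While b c) \<sigma> (1 + btime b + t1 + t2) (max (bwidth b \<sigma>) (max w1 w2)) \<tau>"

inductive_cases SkipE: "exec Skip \<sigma> t w \<tau>"
inductive_cases AssignE: "exec (Assign x e) \<sigma> t w \<tau>"
inductive_cases StoreE: "exec (Store x d e) \<sigma> t w \<tau>"
inductive_cases SeqE: "exec (Seq c1 c2) \<sigma> t w \<tau>"
inductive_cases CondE: "exec (Cond b c1 c2) \<sigma> t w \<tau>"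
inductive_cases WhileE: "exec (While b c) \<sigma> t w \<tau>"

lemma exec_deterministic:
  "exec c \<sigma> t w \<tau> \<Longrightarrow> exec c \<sigma> t' w' \<tau>' \<Longrightarrow> t' = t \<and> w' = w \<and> \<tau>' = \<tau>"
proof (induction arbitrary: t' w' \<tau>' rule: exec.induct)
  case (Skip \<sigma>)
  then show ?case by (auto elim: SkipE)
next
  case (Assign x e \<sigma>)
  then show ?case by (auto elim: AssignE)
next
  case (Store x d e \<sigma>)
  then show ?case by (auto elim: StoreE)
next
  case (Seq c1 \<sigma> t1 w1 \<rho> c2 t2 w2 \<tau>)
  from Seq.prems show ?case by (rule SeqE) (auto dest!: Seq.IH)
next
  case (CondTrue b \<sigma> c1 t w \<tau> c2)
  from CondTrue.prems show ?case by (rule CondE) (use CondTrue.hyps in \<open>auto dest!: CondTrue.IH\<close>)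
next
  case (CondFalse b \<sigma> c2 t w \<tau> c1)
  from CondFalse.prems show ?case by (rule CondE) (use CondFalse.hyps in \<open>auto dest!: CondFalse.IH\<close>)
next
  case (WhileFalse b \<sigma> c)
  from WhileFalse.prems show ?case by (rule WhileE) (use WhileFalse in auto)
next
  case (WhileTrue b \<sigma> c t1 w1 \<rho> t2 w2 \<tau>)
  from WhileTrue.prems show ?case
    by (rule WhileE) (use WhileTrue.hyps in \<open>auto dest!: WhileTrue.IH\<close>)
qed


definition load :: "nat \<Rightarrow> (nat \<Rightarrow> int) \<Rightarrow> int \<Rightarrow> int" where
  "load n f k = (if 1 \<le> k \<and> k \<le> int n then f (nat k) else 0)"

text \<open>The intervals are given by their end points; all other memory is initially zero.\<close>

definition fsc_input :: "nat \<Rightarrow> (nat \<Rightarrow> int) \<Rightarrow> (nat \<Rightarrow> int) \<Rightarrow> (nat \<Rightarrow> int) \<Rightarrow> state" where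
  "fsc_input n a l u =
     \<lparr>vars = (\<lambda>_. 0)(''n'' := int n),
      arrs = (\<lambda>_ _. 0)(''a'' := load n a, ''l'' := load n l, ''u'' := load n u)\<rparr>"

definition fsc_size :: "nat \<Rightarrow> (nat \<Rightarrow> int) \<Rightarrow> (nat \<Rightarrow> int) \<Rightarrow> (nat \<Rightarrow> int) \<Rightarrow> nat" where
  "fsc_size n a l u = (\<Sum>i=1..n. bit_size (a i) + bit_size (l i) + bit_size (u i))"

end

theory Submission
  imports Defs
begin

text \<open>
  Let \<open>S i\<close> be the set of integers that satisfy the first \<open>i\<close> constraints; it has period \<open>a i\<close>.
  Let \<open>z\<close> be the least element of \<open>S (i - 1)\<close> that is at least \<open>x\<close>. If \<open>z\<close> satisfies constraint
  \<open>i\<close>, it is also the least element of \<open>S i\<close> from \<open>x\<close> on. Otherwise every such element lies at or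
  after the next point \<open>y\<close> with \<open>y \<equiv> l i\<close> modulo \<open>a i\<close>. Since \<open>a (i - 1)\<close> divides \<open>a i\<close>, the
  distance from \<open>y\<close> to the next element of \<open>S (i - 1)\<close> is a number \<open>d i\<close> that does not depend on
  \<open>y\<close>, and feasibility forces \<open>d i \<le> u i - l i\<close>; the least element is thus \<open>y + d i\<close>. Each \<open>d i\<close>
  is found by running this recurrence from \<open>x = l i\<close> through the constraints below \<open>i\<close>, and the
  minimal solution by running it from \<open>x = 0\<close>; altogether this takes quadratic time.
\<close>

section \<open>Least solutions from a given point on\<close>

text \<open>A relation rather than a \<open>LEAST\<close> term, since existence of the least element
  has to be carried along as part of the invariant.\<close>

definition least_from :: "(int \<Rightarrow> bool) \<Rightarrow> int \<Rightarrow> int \<Rightarrow> bool" where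
  "least_from P x z \<longleftrightarrow> x \<le> z \<and> P z \<and> (\<forall>y\<ge>x. P y \<longrightarrow> z \<le> y)"

definition periodic_pred :: "(int \<Rightarrow> bool) \<Rightarrow> int \<Rightarrow> bool" where
  "periodic_pred P m \<longleftrightarrow> (\<forall>x y. [x = y] (mod m) \<longrightarrow> P x = P y)"

text \<open>For \<open>m > 0\<close>, the number \<open>z + (m - (z - l) mod m)\<close> is the first
  integer strictly after \<open>z\<close> that is congruent to \<open>l\<close> modulo
  \<open>m\<close>.\<close>

definition advance :: "int \<Rightarrow> int \<Rightarrow> int \<Rightarrow> int \<Rightarrow> int \<Rightarrow> int" where
  "advance m l u d z =
     (if (z - l) mod m \<le> u - l then z else z + (m - (z - l) mod m) + d)"

text \<open>Otherwise \<open>z - m\<close> would be a smaller candidate, by periodicity.\<close>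

lemma least_from_less:
  assumes "least_from P x z" "periodic_pred P m" "m > 0"
  shows "z < x + m"
proof (rule ccontr)
  assume "\<not> z < x + m"
  moreover have "P (z - m)"
  proof -
    have "[z - m = z] (mod m)" by (simp add: cong_iff_dvd_diff)
    then show ?thesis using assms unfolding least_from_def periodic_pred_def by blast
  qed
  ultimately show False
    using assms(1,3) unfolding least_from_def by (auto dest: spec[of _ "z - m"])
qed

text \<open>The witness \<open>y\<close> stands for feasibility: it forces \<open>d < m\<close> and
  \<open>d \<le> u - l\<close>, so that the jump in the second case of \<open>advance\<close> lands
  inside the residue window.\<close>

lemma least_from_advance:
  assumes z: "least_from P x z" and d: "least_from P l (l + d)"
    and P: "periodic_pred P m" and m: "m > 0"
    and y: "P y" "(y - l) mod m \<le> u - l"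
  shows "least_from (\<lambda>y. P y \<and> (y - l) mod m \<le> u - l) x (advance m l u d z)"
proof (cases "(z - l) mod m \<le> u - l")
  case True
  then show ?thesis using z by (simp add: advance_def least_from_def)
next
  case False
  define f where "f = (z - l) mod m"
  \<comment> \<open>Moving \<open>y\<close> by a multiple of \<open>m\<close> to
    \<open>l + (y - l) mod m\<close> keeps it in \<open>P\<close> and puts it at or after
    \<open>l\<close>, where \<open>l + d\<close> is least.\<close>
  have d_le: "d \<le> (y - l) mod m" if "P y" for y
  proof -
    have "[y = l + (y - l) mod m] (mod m)"
      by (simp add: cong_def mod_add_right_eq)
    then have "P (l + (y - l) mod m)" using P that unfolding periodic_pred_def by blast
    moreover have "0 \<le> (y - l) mod m" using m by simp
    ultimately have "l + d \<le> l + (y - l) mod m"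
      using d unfolding least_from_def by (metis le_add_same_cancel1)
    then show ?thesis by simp
  qed
  have d0: "0 \<le> d" using d by (simp add: least_from_def)
  have f: "0 \<le> f" "f < m" using m by (simp_all add: f_def)
  have w: "m dvd (z + (m - f)) - l"
  proof -
    have "m dvd (z - l) - f" unfolding f_def by (rule dvd_minus_mod)
    then have "m dvd ((z - l) - f) + m" by simp
    then show ?thesis by (simp add: algebra_simps)
  qed
  then have "[z + (m - f) + d = l + d] (mod m)" by (simp add: cong_iff_dvd_diff)
  then have 1: "P (z + (m - f) + d)" using P d unfolding periodic_pred_def least_from_def by blast
  \<comment> \<open>Since \<open>0 \<le> d < m\<close>, the residue of the new point relative to
    \<open>l\<close> is \<open>d\<close> itself.\<close>
  have "d < m" using d_le[OF y(1)] pos_mod_bound[OF m, of "y - l"] by linarith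
  moreover have "(z + (m - f) + d - l) mod m = d mod m"
    using w by (simp add: mod_eq_dvd_iff algebra_simps)
  ultimately have 2: "(z + (m - f) + d - l) mod m \<le> u - l"
    using d0 d_le[OF y(1)] y(2) by simp
  \<comment> \<open>Round \<open>y\<close> and \<open>z\<close> down to the points
    \<open>y - e\<close> and \<open>z - f\<close>, both congruent to \<open>l\<close>. From
    \<open>z \<le> y\<close> and \<open>e \<le> u - l < f\<close> the first is strictly larger,
    hence larger by at least \<open>m\<close>; finally \<open>e\<close> is at least
    \<open>d\<close>.\<close>
  have 3: "z + (m - f) + d \<le> y" if y: "x \<le> y" "P y" "(y - l) mod m \<le> u - l" for y
  proof -
    define e where "e = (y - l) mod m"
    have zy: "z \<le> y" using z y unfolding least_from_def by blast
    have "m dvd ((y - l) - e) - ((z - l) - f)"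
      unfolding e_def f_def by (intro dvd_diff dvd_minus_mod)
    moreover have "((y - l) - e) - ((z - l) - f) > 0"
      using zy False y(3) unfolding e_def f_def by linarith
    ultimately have "m \<le> ((y - l) - e) - ((z - l) - f)" by (rule zdvd_imp_le)
    then show ?thesis using d_le[OF y(2)] unfolding e_def by linarith
  qed
  have "x \<le> z + (m - f) + d" using z f d0 unfolding least_from_def by linarith
  then show ?thesis
    using False 1 2 3 unfolding least_from_def advance_def f_def by auto
qed

text \<open>The number \<open>l + (x - l) mod m\<close> is the smallest one from \<open>l\<close> on
  that is congruent to \<open>x\<close>, so it suffices to test it against \<open>u\<close>. This
  covers empty intervals as well.\<close>

lemma cong_interval_iff:
  fixes m :: int
  assumes "m > 0"
  shows "(\<exists>r\<in>{l..u}. [x = r] (mod m)) \<longleftrightarrow> (x - l) mod m \<le> u - l"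
proof
  assume "\<exists>r\<in>{l..u}. [x = r] (mod m)"
  then obtain r where r: "l \<le> r" "r \<le> u" "[x = r] (mod m)" by auto
  then have "(x - l) mod m = (r - l) mod m" by (metis cong_def cong_diff cong_refl)
  also have "\<dots> \<le> r - l" using r assms by (intro zmod_le_nonneg_dividend) simp
  finally show "(x - l) mod m \<le> u - l" using r by simp
next
  assume "(x - l) mod m \<le> u - l"
  moreover have "[x = l + (x - l) mod m] (mod m)" by (simp add: cong_def mod_add_right_eq)
  ultimately show "\<exists>r\<in>{l..u}. [x = r] (mod m)"
    using assms by (intro bexI[of _ "l + (x - l) mod m"]) auto
qed

section \<open>Bounds on time and width\<close>

lemma bit_size_le:
  assumes "\<bar>z\<bar> < 2 ^ k"
  shows "bit_size z \<le> Suc k"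
proof -
  have "nat \<bar>z\<bar> < 2 ^ k" using assms by (simp add: nat_less_iff)
  then show ?thesis by (simp add: bit_size_def floorlog_leI)
qed

lemma abs_less_bit_size: "\<bar>z\<bar> < 2 ^ bit_size z"
proof -
  have "nat \<bar>z\<bar> < 2 ^ floorlog 2 (nat \<bar>z\<bar>)"
    using floorlog_bounds[of "nat \<bar>z\<bar>" 2] by (cases "z = 0") (auto simp: floorlog_def)
  also have "\<dots> \<le> 2 ^ bit_size z" by (simp add: bit_size_def)
  finally show ?thesis by (simp add: nat_less_iff)
qed

text \<open>A total-correctness weakest precondition: the time is handed to the postcondition,
  whereas the width only has to respect one global bound. The equivalences below then let
  simplification execute loop-free code symbolically.\<close>

definition runs :: "com \<Rightarrow> state \<Rightarrow> nat \<Rightarrow> (nat \<Rightarrow> state \<Rightarrow> bool) \<Rightarrow> bool" where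
  "runs c \<sigma> W Q \<longleftrightarrow> (\<exists>t w \<tau>. exec c \<sigma> t w \<tau> \<and> w \<le> W \<and> Q t \<tau>)"

lemma runs_mono:
  assumes "runs c \<sigma> W Q" "\<And>t \<tau>. Q t \<tau> \<Longrightarrow> Q' t \<tau>"
  shows "runs c \<sigma> W Q'"
  using assms unfolding runs_def by blast

lemma runs_Skip [simp]: "runs Skip \<sigma> W Q \<longleftrightarrow> Q 1 \<sigma>"
proof
  show "Q 1 \<sigma> \<Longrightarrow> runs Skip \<sigma> W Q" using exec.Skip unfolding runs_def by blast
qed (auto simp: runs_def elim: SkipE)

lemma runs_Assign [simp]:
  "runs (Assign x e) \<sigma> W Q \<longleftrightarrow>
     awidth e \<sigma> \<le> W \<and> Q (1 + atime e) (\<sigma>\<lparr>vars := (vars \<sigma>)(x := aval e \<sigma>)\<rparr>)"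
    (is "_ \<longleftrightarrow> ?R")
proof
  show "?R \<Longrightarrow> runs (Assign x e) \<sigma> W Q" using exec.Assign unfolding runs_def by blast
qed (auto simp: runs_def elim!: AssignE)

lemma runs_Store [simp]:
  "runs (Store x d e) \<sigma> W Q \<longleftrightarrow> awidth d \<sigma> \<le> W \<and> awidth e \<sigma> \<le> W \<and>
     Q (1 + atime d + atime e)
       (\<sigma>\<lparr>arrs := (arrs \<sigma>)(x := (arrs \<sigma> x)(aval d \<sigma> := aval e \<sigma>))\<rparr>)"
    (is "_ \<longleftrightarrow> ?R")
proof
  show "?R \<Longrightarrow> runs (Store x d e) \<sigma> W Q"
    using exec.Store[of x d e \<sigma>] unfolding runs_def by (meson max.boundedI)
qed (auto simp: runs_def elim!: StoreE)

lemma runs_Seq [simp]: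
  "runs (Seq c1 c2) \<sigma> W Q \<longleftrightarrow>
     runs c1 \<sigma> W (\<lambda>t1 \<rho>. runs c2 \<rho> W (\<lambda>t2 \<tau>. Q (1 + t1 + t2) \<tau>))"
proof
  assume "runs (Seq c1 c2) \<sigma> W Q"
  then show "runs c1 \<sigma> W (\<lambda>t1 \<rho>. runs c2 \<rho> W (\<lambda>t2 \<tau>. Q (1 + t1 + t2) \<tau>))"
    unfolding runs_def by (auto elim!: SeqE) metis
next
  assume "runs c1 \<sigma> W (\<lambda>t1 \<rho>. runs c2 \<rho> W (\<lambda>t2 \<tau>. Q (1 + t1 + t2) \<tau>))"
  then show "runs (Seq c1 c2) \<sigma> W Q"
    unfolding runs_def by (meson exec.Seq max.boundedI)
qed

lemma runs_Cond [simp]: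
  "runs (Cond b c1 c2) \<sigma> W Q \<longleftrightarrow> bwidth b \<sigma> \<le> W \<and>
     runs (if bval b \<sigma> then c1 else c2) \<sigma> W (\<lambda>t \<tau>. Q (1 + btime b + t) \<tau>)"
proof
  assume "runs (Cond b c1 c2) \<sigma> W Q"
  then show "bwidth b \<sigma> \<le> W \<and>
     runs (if bval b \<sigma> then c1 else c2) \<sigma> W (\<lambda>t \<tau>. Q (1 + btime b + t) \<tau>)"
    unfolding runs_def by (cases "bval b \<sigma>") (fastforce elim!: CondE)+
next
  assume "bwidth b \<sigma> \<le> W \<and>
     runs (if bval b \<sigma> then c1 else c2) \<sigma> W (\<lambda>t \<tau>. Q (1 + btime b + t) \<tau>)"
  then show "runs (Cond b c1 c2) \<sigma> W Q"
    unfolding runs_def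
    by (cases "bval b \<sigma>"; simp only: if_True if_False)
      (meson exec.CondTrue exec.CondFalse max.boundedI)+
qed

text \<open>The invariant is indexed by the number of completed iterations, of which there are
  exactly \<open>m\<close>; each costs at most \<open>T\<close> plus its test, and one failing test
  is added.\<close>

lemma runs_While:
  assumes "I 0 \<sigma>"
    and body: "\<And>i \<sigma>. i < m \<Longrightarrow> I i \<sigma> \<Longrightarrow>
      bval b \<sigma> \<and> bwidth b \<sigma> \<le> W \<and> runs c \<sigma> W (\<lambda>t \<tau>. t \<le> T \<and> I (Suc i) \<tau>)"
    and exit: "\<And>\<sigma>. I m \<sigma> \<Longrightarrow> \<not> bval b \<sigma> \<and> bwidth b \<sigma> \<le> W"
  shows "runs (While b c) \<sigma> W (\<lambda>t \<tau>. t \<le> m * (1 + btime b + T) + (1 + btime b) \<and> I m \<tau>)"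
proof -
  \<comment> \<open>Induction on the number \<open>k\<close> of iterations still to come, for an
    arbitrary intermediate state.\<close>
  have "runs (While b c) \<sigma> W (\<lambda>t \<tau>. t \<le> k * (1 + btime b + T) + (1 + btime b) \<and> I m \<tau>)"
    if "i + k = m" "I i \<sigma>" for i k \<sigma>
    using that
  proof (induction k arbitrary: i \<sigma>)
    case 0
    then show ?case using exit[of \<sigma>] exec.WhileFalse[of b \<sigma> c] unfolding runs_def by auto
  next
    case (Suc k)
    from body[of i \<sigma>] Suc.prems obtain t1 w1 \<rho> where
      1: "bval b \<sigma>" "bwidth b \<sigma> \<le> W" "exec c \<sigma> t1 w1 \<rho>" "w1 \<le> W" "t1 \<le> T" "I (Suc i) \<rho>"
      unfolding runs_def by auto
    from Suc.IH[of "Suc i" \<rho>] Suc.prems 1 obtain t2 w2 \<tau> where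
      2: "exec (While b c) \<rho> t2 w2 \<tau>" "w2 \<le> W" "t2 \<le> k * (1 + btime b + T) + (1 + btime b)"
         "I m \<tau>"
      unfolding runs_def by auto
    have "exec (While b c) \<sigma> (1 + btime b + t1 + t2) (max (bwidth b \<sigma>) (max w1 w2)) \<tau>"
      using 1 2 by (intro exec.WhileTrue)
    moreover have "1 + btime b + t1 + t2 \<le> Suc k * (1 + btime b + T) + (1 + btime b)"
      using 1 2 by simp
    ultimately show ?case unfolding runs_def using 1 2 by (meson max.boundedI)
  qed
  from this[of 0 m] assms(1) show ?thesis by simp
qed

section \<open>The program\<close>

definition advance_com :: "vname \<Rightarrow> vname \<Rightarrow> com" where
  "advance_com x i =
     Seq (Assign ''e'' (Bin Mod (Bin Sub (V x) (Elem ''l'' (V i))) (Elem ''a'' (V i))))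
       (Cond (Less (Bin Sub (Elem ''u'' (V i)) (Elem ''l'' (V i))) (V ''e''))
         (Assign x (Bin Add (Bin Add (V x) (Bin Sub (Elem ''a'' (V i)) (V ''e'')))
           (Elem ''d'' (V i))))
         Skip)"

definition incr_com :: "vname \<Rightarrow> com" where
  "incr_com x = Assign x (Bin Add (V x) (N 1))"

definition inner_com :: com where
  "inner_com = While (Less (V ''j'') (V ''k'')) (Seq (advance_com ''z'' ''j'') (incr_com ''j''))"

text \<open>Both recurrences share one pass: round \<open>k\<close> computes and stores the offset
  of constraint \<open>k\<close> from the earlier offsets, and at once uses it to advance
  \<open>''s''\<close>.\<close>

definition fsc_body :: com where
  "fsc_body =
     Seq (Assign ''z'' (Elem ''l'' (V ''k'')))
    (Seq (Assign ''j'' (N 1))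
    (Seq inner_com
    (Seq (Store ''d'' (V ''k'') (Bin Sub (V ''z'') (Elem ''l'' (V ''k''))))
    (Seq (advance_com ''s'' ''k'')
         (incr_com ''k'')))))"

definition fsc_com :: com where
  "fsc_com =
     Seq (Assign ''k'' (N 1)) (While (Less (V ''k'') (Bin Add (V ''n'') (N 1))) fsc_body)"

lemma runs_advance_com:
  fixes B :: int
  assumes x: "x \<noteq> ''e''" "i \<noteq> ''e''" "x \<noteq> i"
    and W: "\<And>v. \<bar>v\<bar> < 8 * B \<Longrightarrow> bit_size v \<le> W"
    and z: "\<bar>vars \<sigma> x\<bar> < 2 * B" and i: "\<bar>vars \<sigma> i\<bar> < B"
    and m: "arrs \<sigma> ''a'' (vars \<sigma> i) = m" "0 < m" "m < B"
    and l: "arrs \<sigma> ''l'' (vars \<sigma> i) = l" "\<bar>l\<bar> < B"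
    and u: "arrs \<sigma> ''u'' (vars \<sigma> i) = u" "\<bar>u\<bar> < B"
    and d: "arrs \<sigma> ''d'' (vars \<sigma> i) = d" "\<bar>d\<bar> < B"
    and Q: "\<And>t. t \<le> 30 \<Longrightarrow>
      Q t (\<sigma>\<lparr>vars := (vars \<sigma>)(''e'' := (vars \<sigma> x - l) mod m, x := advance m l u d (vars \<sigma> x))\<rparr>)"
  shows "runs (advance_com x i) \<sigma> W Q"
proof -
  define e where "e = (vars \<sigma> x - l) mod m"
  have e: "0 \<le> e" "e < m" using m by (simp_all add: e_def)
  \<comment> \<open>When no jump is made, the value that \<open>Q\<close> assigns to
    \<open>x\<close> is its old one.\<close>
  have upd: "(vars \<sigma>)(''e'' := e, x := vars \<sigma> x) = (vars \<sigma>)(''e'' := e)" using x by auto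
  note Q = Q[folded e_def, unfolded advance_def, folded e_def]
  have "0 < B" using m by linarith
  \<comment> \<open>The largest bound arises for the jump target: \<open>2 * B\<close> for the old
    point and \<open>B\<close> each for \<open>m - e\<close> and \<open>d\<close>, which is well
    within \<open>8 * B\<close>.\<close>
  then have widths: "bit_size l \<le> W" "bit_size u \<le> W" "bit_size d \<le> W" "bit_size m \<le> W"
      "bit_size e \<le> W" "bit_size (vars \<sigma> x) \<le> W" "bit_size (vars \<sigma> i) \<le> W"
      "bit_size (vars \<sigma> x - l) \<le> W" "bit_size (u - l) \<le> W" "bit_size (m - e) \<le> W"
      "bit_size (vars \<sigma> x + (m - e)) \<le> W" "bit_size (vars \<sigma> x + (m - e) + d) \<le> W"
    using l(2) u(2) d(2) z i m(2,3) e by (intro W; linarith)+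
  show ?thesis
  proof (cases "e \<le> u - l")
    case True
    \<comment> \<open>The exact running times are 18 without and 27 with the jump.\<close>
    then show ?thesis using x Q[of 18]
      by (simp add: advance_com_def m(1) l(1) u(1) e_def[symmetric] widths upd numeral_eq_Suc)
  next
    case False
    then show ?thesis using x Q[of 27]
      by (simp add: advance_com_def m(1) l(1) u(1) d(1) e_def[symmetric] widths numeral_eq_Suc)
  qed
qed

section \<open>Prefixes of the constraints of a feasible instance\<close>

locale fsc_instance =
  fixes n :: nat and a l u :: "nat \<Rightarrow> int"
  assumes harmonic: "harmonic_divisors n a"
    and feasible: "fsc_feasible n a (\<lambda>i. {l i..u i})"
begin

definition sat_upto :: "nat \<Rightarrow> int \<Rightarrow> bool" where
  "sat_upto i x \<longleftrightarrow> (\<forall>j\<in>{1..i}. (x - l j) mod a j \<le> u j - l j)"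

text \<open>All input numbers and \<open>n\<close> are below this bound in absolute value; being a
  power of two, it converts directly into a bit length.\<close>

definition B :: int where
  "B = 2 ^ fsc_size n a l u"

lemma a_pos: "j \<in> {1..n} \<Longrightarrow> 0 < a j"
  using harmonic unfolding harmonic_divisors_def by fastforce

lemma a_dvd:
  assumes "i \<le> j" "1 \<le> i" "j \<le> n"
  shows "a i dvd a j"
  using assms
proof (induction j rule: dec_induct)
  case (step j)
  then have "a j dvd a (Suc j)" using harmonic unfolding harmonic_divisors_def by auto
  then show ?case using step by (meson dvd_trans Suc_leD)
qed simp

lemma sat_upto_0 [simp]: "sat_upto 0 x"
  by (simp add: sat_upto_def)

lemma sat_upto_Suc:
  "sat_upto (Suc i) x \<longleftrightarrow> sat_upto i x \<and> (x - l (Suc i)) mod a (Suc i) \<le> u (Suc i) - l (Suc i)"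
  by (auto simp: sat_upto_def atLeastAtMostSuc_conv)

text \<open>This is where the divisibility chain enters: \<open>a j\<close> is a multiple of every
  earlier modulus. The case \<open>j = i + 1\<close> serves the recurrence, the case
  \<open>j = i\<close> the size bound.\<close>

lemma sat_upto_periodic:
  assumes "i \<le> j" "1 \<le> j" "j \<le> n"
  shows "periodic_pred (sat_upto i) (a j)"
  unfolding periodic_pred_def
proof (intro allI impI)
  fix x y assume xy: "[x = y] (mod a j)"
  have "(x - l k) mod a k = (y - l k) mod a k" if "k \<in> {1..i}" for k
  proof -
    have "[x = y] (mod a k)" using xy a_dvd[of k j] assms that by (auto intro: cong_dvd_modulus)
    then show ?thesis by (metis cong_def cong_diff cong_refl)
  qed
  then show "sat_upto i x = sat_upto i y" unfolding sat_upto_def by simp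
qed

lemma fsc_solution_iff: "fsc_solution n a (\<lambda>i. {l i..u i}) s \<longleftrightarrow> sat_upto n (int s)"
  unfolding fsc_solution_def sat_upto_def using cong_interval_iff a_pos by simp

lemma sat_upto_solution: "\<exists>s. sat_upto n s"
  using feasible unfolding fsc_feasible_def fsc_solution_iff by blast

lemma sat_upto_mono: "sat_upto j x \<Longrightarrow> i \<le> j \<Longrightarrow> sat_upto i x"
  unfolding sat_upto_def by auto

text \<open>A single solution of the whole instance satisfies every prefix and so provides the
  witness for \<open>least_from_advance\<close> in each step.\<close>

lemma least_from_step:
  assumes "i < n" "least_from (sat_upto i) x z"
    "least_from (sat_upto i) (l (Suc i)) (l (Suc i) + d)"
  shows "least_from (sat_upto (Suc i)) x (advance (a (Suc i)) (l (Suc i)) (u (Suc i)) d z)"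
proof -
  obtain y where "sat_upto (Suc i) y"
    using sat_upto_solution sat_upto_mono assms(1) by (meson Suc_leI)
  then have "least_from (\<lambda>y. sat_upto i y \<and> (y - l (Suc i)) mod a (Suc i) \<le> u (Suc i) - l (Suc i))
      x (advance (a (Suc i)) (l (Suc i)) (u (Suc i)) d z)"
    using assms by (intro least_from_advance[where y = y] sat_upto_periodic a_pos)
      (auto simp: sat_upto_Suc)
  then show ?thesis unfolding sat_upto_Suc[abs_def] .
qed

lemma s_min_eq:
  assumes "least_from (sat_upto n) 0 z"
  shows "int (s_min n a (\<lambda>i. {l i..u i})) = z"
proof -
  have "s_min n a (\<lambda>i. {l i..u i}) = nat z"
    unfolding s_min_def fsc_solution_iff
    using assms by (intro Least_equality) (auto simp: least_from_def nat_le_iff)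
  then show ?thesis using assms by (simp add: least_from_def)
qed

section \<open>Magnitude of the numbers that occur\<close>

lemma B_pos: "1 \<le> B"
  unfolding B_def by simp

lemma bit_size_le_fsc_size:
  assumes "i \<in> {1..n}"
  shows "bit_size (a i) + bit_size (l i) + bit_size (u i) \<le> fsc_size n a l u"
  unfolding fsc_size_def using assms
  by (intro member_le_sum[where f = "\<lambda>i. bit_size (a i) + bit_size (l i) + bit_size (u i)"]) auto

lemma input_less_B:
  assumes "i \<in> {1..n}"
  shows "\<bar>a i\<bar> < B" "\<bar>l i\<bar> < B" "\<bar>u i\<bar> < B"
proof -
  have "\<bar>v\<bar> < B" if "bit_size v \<le> fsc_size n a l u" for v
    using abs_less_bit_size[of v] that power_increasing[OF that, of "2::int"]
    unfolding B_def by linarith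
  then show "\<bar>a i\<bar> < B" "\<bar>l i\<bar> < B" "\<bar>u i\<bar> < B"
    using bit_size_le_fsc_size[OF assms] by simp_all
qed

text \<open>Each constraint contributes at least one sign bit to the input size, so \<open>n\<close>
  is at most that size.\<close>

lemma n_less_B: "int n < B"
proof -
  have "n = (\<Sum>i=1..n. 1)" by simp
  also have "\<dots> \<le> fsc_size n a l u"
    unfolding fsc_size_def by (intro sum_mono) (simp add: bit_size_def)
  finally have "n < 2 ^ fsc_size n a l u" using less_exp order_le_less_trans by blast
  then show ?thesis unfolding B_def by (metis of_nat_less_iff of_nat_numeral of_nat_power)
qed

lemma bit_size_le_W: "\<bar>v\<bar> < 8 * B \<Longrightarrow> bit_size v \<le> fsc_size n a l u + 4"
  \<comment> \<open>The factor 8 costs three bits, the sign one more.\<close>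
  using bit_size_le[of v "fsc_size n a l u + 3"] by (simp add: B_def power_add)

lemma least_from_less_B:
  assumes "least_from (sat_upto i) x z" "i \<le> n"
  shows "z < x + B"
\<comment> \<open>The empty prefix has no modulus to serve as a period, but there the least element
  is \<open>x\<close> itself.\<close>
proof (cases "i = 0")
  case True
  then have "z = x" using assms by (force simp: least_from_def)
  then show ?thesis using B_pos by simp
next
  case False
  then have "z < x + a i"
    using assms by (intro least_from_less[OF assms(1)] sat_upto_periodic a_pos) auto
  then show ?thesis using False assms input_less_B(1)[of i] by simp
qed

section \<open>Loop invariants, correctness and cost\<close>

definition offset_spec :: "nat \<Rightarrow> int \<Rightarrow> bool" where
  "offset_spec j d \<longleftrightarrow> least_from (sat_upto (j - 1)) (l j) (l j + d)"

text \<open>Here \<open>k\<close> counts the constraints already handled, so the program variable is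
  one ahead. The variables \<open>''z''\<close>, \<open>''j''\<close> and \<open>''e''\<close> are
  left free as scratch.\<close>

definition inv :: "nat \<Rightarrow> state \<Rightarrow> bool" where
  "inv k \<sigma> \<longleftrightarrow> k \<le> n \<and> vars \<sigma> ''n'' = int n \<and> vars \<sigma> ''k'' = int k + 1 \<and>
     arrs \<sigma> ''a'' = load n a \<and> arrs \<sigma> ''l'' = load n l \<and> arrs \<sigma> ''u'' = load n u \<and>
     least_from (sat_upto k) 0 (vars \<sigma> ''s'') \<and>
     (\<forall>j\<in>{1..k}. offset_spec j (arrs \<sigma> ''d'' (int j)))"

definition inner_inv :: "nat \<Rightarrow> nat \<Rightarrow> state \<Rightarrow> bool" where
  "inner_inv k i \<sigma> \<longleftrightarrow> inv k \<sigma> \<and> i \<le> k \<and> vars \<sigma> ''j'' = int i + 1 \<and>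
     least_from (sat_upto i) (l (Suc k)) (vars \<sigma> ''z'')"

lemma load_Suc [simp]: "i < n \<Longrightarrow> load n f (int i + 1) = f (Suc i)"
  by (simp add: load_def nat_add_distrib)

lemma offset_bounds:
  assumes "offset_spec j d" "j \<in> {1..n}"
  shows "0 \<le> d" "d < B"
  using assms least_from_less_B[of "j - 1" "l j" "l j + d"]
  by (auto simp: offset_spec_def least_from_def)

abbreviation W :: nat where
  "W \<equiv> fsc_size n a l u + 4"

text \<open>Serves both recurrences, with \<open>b = 0\<close> for \<open>''s''\<close> and
  \<open>b = l (Suc k)\<close> for \<open>''z''\<close>. The bound on \<open>b\<close> keeps the
  current point below \<open>2 * B\<close> in absolute value.\<close>

lemma runs_advance:
  assumes "i < n" and x: "x \<noteq> ''e''" "y \<noteq> ''e''" "x \<noteq> y"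
    and arrs: "arrs \<sigma> ''a'' = load n a" "arrs \<sigma> ''l'' = load n l" "arrs \<sigma> ''u'' = load n u"
    and y: "vars \<sigma> y = int i + 1"
    and d: "offset_spec (Suc i) (arrs \<sigma> ''d'' (int i + 1))"
    and z: "least_from (sat_upto i) b (vars \<sigma> x)" "\<bar>b\<bar> < B"
    and Q: "\<And>t e z'. t \<le> 30 \<Longrightarrow> least_from (sat_upto (Suc i)) b z' \<Longrightarrow>
      Q t (\<sigma>\<lparr>vars := (vars \<sigma>)(''e'' := e, x := z')\<rparr>)"
  shows "runs (advance_com x y) \<sigma> W Q"
proof (rule runs_advance_com[where B = B and m = "a (Suc i)" and l = "l (Suc i)"
      and u = "u (Suc i)" and d = "arrs \<sigma> ''d'' (vars \<sigma> y)"])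
  show "\<bar>vars \<sigma> x\<bar> < 2 * B"
    using z least_from_less_B[OF z(1)] \<open>i < n\<close> unfolding least_from_def by linarith
  show "\<bar>vars \<sigma> y\<bar> < B" using y \<open>i < n\<close> n_less_B by simp
  show "\<bar>arrs \<sigma> ''d'' (vars \<sigma> y)\<bar> < B" using offset_bounds[OF d] \<open>i < n\<close> y by simp
  show "Q t (\<sigma>\<lparr>vars := (vars \<sigma>)(''e'' := (vars \<sigma> x - l (Suc i)) mod a (Suc i),
      x := advance (a (Suc i)) (l (Suc i)) (u (Suc i)) (arrs \<sigma> ''d'' (vars \<sigma> y)) (vars \<sigma> x))\<rparr>)"
    if "t \<le> 30" for t
    using that d y by (intro Q least_from_step \<open>i < n\<close> z(1)) (simp_all add: offset_spec_def)
qed (use x bit_size_le_W arrs y \<open>i < n\<close> a_pos[of "Suc i"] input_less_B[of "Suc i"] in auto)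

lemma runs_inner:
  assumes "inner_inv k 0 \<sigma>" "k < n"
  shows "runs inner_com \<sigma> W (\<lambda>t \<tau>. t \<le> n * 50 + 10 \<and> inner_inv k k \<tau>)"
proof -
  have "runs inner_com \<sigma> W (\<lambda>t \<tau>.
      t \<le> k * (1 + btime (Less (V ''j'') (V ''k'')) + 40) + (1 + btime (Less (V ''j'') (V ''k''))) \<and>
      inner_inv k k \<tau>)"
    unfolding inner_com_def
  proof (rule runs_While[where I = "inner_inv k"])
    show "inner_inv k 0 \<sigma>" by fact
  next
    fix i \<rho> assume i: "i < k" and inv: "inner_inv k i \<rho>"
    have "runs (Seq (advance_com ''z'' ''j'') (incr_com ''j'')) \<rho> W
        (\<lambda>t \<tau>. t \<le> 40 \<and> inner_inv k (Suc i) \<tau>)"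
      unfolding runs_Seq
    proof (rule runs_advance[where i = i and b = "l (Suc k)"])
      show "\<bar>l (Suc k)\<bar> < B" using input_less_B(2)[of "Suc k"] assms by simp
      show "offset_spec (Suc i) (arrs \<rho> ''d'' (int i + 1))"
        using inv i unfolding inner_inv_def inv_def
        by (metis Suc_eq_plus1 Suc_leI atLeastAtMost_iff le_add2 of_nat_Suc add.commute)
    qed (use inv i assms n_less_B B_pos in
        \<open>auto simp: inner_inv_def inv_def incr_com_def intro!: bit_size_le_W\<close>)
    then show "bval (Less (V ''j'') (V ''k'')) \<rho> \<and> bwidth (Less (V ''j'') (V ''k'')) \<rho> \<le> W \<and>
        runs (Seq (advance_com ''z'' ''j'') (incr_com ''j'')) \<rho> W
          (\<lambda>t \<tau>. t \<le> 40 \<and> inner_inv k (Suc i) \<tau>)"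
      using inv i assms n_less_B by (auto simp: inner_inv_def inv_def intro!: bit_size_le_W)
  next
    fix \<rho> assume "inner_inv k k \<rho>"
    then show "\<not> bval (Less (V ''j'') (V ''k'')) \<rho> \<and> bwidth (Less (V ''j'') (V ''k'')) \<rho> \<le> W"
      using assms n_less_B by (auto simp: inner_inv_def inv_def intro!: bit_size_le_W)
  qed
  then show ?thesis by (rule runs_mono) (use assms in auto)
qed

lemma runs_body:
  assumes inv: "inv k \<sigma>" and k: "k < n"
  shows "runs fsc_body \<sigma> W (\<lambda>t \<tau>. t \<le> n * 50 + 100 \<and> inv (Suc k) \<tau>)"
proof -
  have l: "\<bar>l (Suc k)\<bar> < B" using input_less_B(2)[of "Suc k"] k by simp
  \<comment> \<open>Separates the array cell written in this round from the offsets stored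
    earlier.\<close>
  have j_eq: "int j = int k + 1 \<longleftrightarrow> j = Suc k" for j by linarith
  let ?\<rho> = "\<sigma>\<lparr>vars := (vars \<sigma>)(''z'' := l (Suc k), ''j'' := 1)\<rparr>"
  \<comment> \<open>With no constraint imposed, the starting point \<open>l (Suc k)\<close> is its
    own least element.\<close>
  have "inner_inv k 0 ?\<rho>" using inv by (auto simp: inner_inv_def inv_def least_from_def)
  from runs_inner[OF this k]
  have inner: "runs inner_com ?\<rho> W (\<lambda>t \<tau>. t \<le> n * 50 + 10 \<and> inner_inv k k \<tau>)" .
  let ?upd = "\<lambda>\<tau>. \<tau>\<lparr>arrs := (arrs \<tau>)(''d'' := (arrs \<tau> ''d'')
      (int k + 1 := vars \<tau> ''z'' - l (Suc k)))\<rparr>"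
  have rest: "runs (Seq (advance_com ''s'' ''k'') (incr_com ''k'')) (?upd \<tau>) W
      (\<lambda>t \<tau>'. t \<le> 40 \<and> inv (Suc k) \<tau>')"
    if \<tau>: "inner_inv k k \<tau>" for \<tau>
    unfolding runs_Seq
  proof (rule runs_advance[where i = k and b = 0])
    show "\<bar>0\<bar> < B" using B_pos by simp
    \<comment> \<open>The stored value is \<open>''z''\<close> minus \<open>l (Suc k)\<close>, and
      the inner loop has left in \<open>''z''\<close> the least element from
      \<open>l (Suc k)\<close> on for the first \<open>k\<close> constraints.\<close>
    show "offset_spec (Suc k) (arrs (?upd \<tau>) ''d'' (int k + 1))"
      using \<tau> by (simp add: offset_spec_def inner_inv_def)
  qed (use \<tau> k n_less_B B_pos in
      \<open>auto simp: inner_inv_def inv_def incr_com_def offset_spec_def le_Suc_eq j_eq intro!: bit_size_le_W\<close>)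
  have store: "bit_size (vars \<tau> ''z'') \<le> W" "bit_size (vars \<tau> ''z'' - l (Suc k)) \<le> W"
    if "inner_inv k k \<tau>" for \<tau>
  proof -
    have "l (Suc k) \<le> vars \<tau> ''z''" "vars \<tau> ''z'' < l (Suc k) + B"
      using that least_from_less_B[of k "l (Suc k)" "vars \<tau> ''z''"] k
      unfolding inner_inv_def by (blast intro: less_imp_le least_from_def[THEN iffD1, THEN conjunct1])+
    then show "bit_size (vars \<tau> ''z'') \<le> W" "bit_size (vars \<tau> ''z'' - l (Suc k)) \<le> W"
      using l by (intro bit_size_le_W; linarith)+
  qed
  let ?tail = "Seq (Store ''d'' (V ''k'') (Bin Sub (V ''z'') (Elem ''l'' (V ''k''))))
    (Seq (advance_com ''s'' ''k'') (incr_com ''k''))"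
  have tail: "runs ?tail \<tau> W (\<lambda>t \<tau>'. t \<le> 50 \<and> inv (Suc k) \<tau>')" if \<tau>: "inner_inv k k \<tau>" for \<tau>
  proof -
    have "bit_size (int k + 1) \<le> W" "bit_size (l (Suc k)) \<le> W"
      using k l n_less_B by (auto intro!: bit_size_le_W)
    moreover have "vars \<tau> ''k'' = int k + 1" "arrs \<tau> ''l'' = load n l"
      using \<tau> by (auto simp: inner_inv_def inv_def)
    ultimately show ?thesis
      using store[OF \<tau>] k unfolding runs_Seq[of "Store _ _ _"] runs_Store
      by (auto simp del: runs_Seq intro!: runs_mono[OF rest[OF \<tau>]])
  qed
  have "runs (Seq inner_com ?tail) ?\<rho> W (\<lambda>t \<tau>. t \<le> n * 50 + 61 \<and> inv (Suc k) \<tau>)"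
    unfolding runs_Seq[of inner_com]
  proof (rule runs_mono[OF inner])
    fix t \<tau> assume t: "t \<le> n * 50 + 10 \<and> inner_inv k k \<tau>"
    show "runs ?tail \<tau> W (\<lambda>t2 \<tau>. 1 + t + t2 \<le> n * 50 + 61 \<and> inv (Suc k) \<tau>)"
      by (rule runs_mono[OF tail]) (use t in auto)
  qed
  moreover have "bit_size (int k + 1) \<le> W" "bit_size (l (Suc k)) \<le> W" "bit_size 1 \<le> W"
    using k l n_less_B B_pos by (auto intro!: bit_size_le_W)
  moreover have "vars \<sigma> ''k'' = int k + 1" "arrs \<sigma> ''l'' = load n l"
    using inv by (auto simp: inv_def)
  ultimately show ?thesis
    using k unfolding fsc_body_def runs_Seq[of "Assign _ _"] runs_Assign
    by (auto simp del: runs_Seq elim!: runs_mono)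
qed

lemma runs_fsc:
  "runs fsc_com (fsc_input n a l u) W
     (\<lambda>t \<tau>. t \<le> n * (n * 50 + 110) + 20 \<and>
        vars \<tau> ''s'' = int (s_min n a (\<lambda>i. {l i..u i})))"
proof -
  let ?b = "Less (V ''k'') (Bin Add (V ''n'') (N 1))"
  let ?\<sigma> = "(fsc_input n a l u)\<lparr>vars := (vars (fsc_input n a l u))(''k'' := 1)\<rparr>"
  have "runs (While ?b fsc_body) ?\<sigma> W (\<lambda>t \<tau>.
      t \<le> n * (1 + btime ?b + (n * 50 + 100)) + (1 + btime ?b) \<and> inv n \<tau>)"
  proof (rule runs_While[where I = inv])
    \<comment> \<open>The zero-initialised \<open>''s''\<close> is the least nonnegative integer, as
      required for the empty prefix.\<close>
    show "inv 0 ?\<sigma>" by (auto simp: inv_def fsc_input_def least_from_def)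
  next
    fix k \<rho> assume k: "k < n" and inv: "inv k \<rho>"
    then show "bval ?b \<rho> \<and> bwidth ?b \<rho> \<le> W \<and>
        runs fsc_body \<rho> W (\<lambda>t \<tau>. t \<le> n * 50 + 100 \<and> inv (Suc k) \<tau>)"
      using runs_body[OF inv k] n_less_B by (auto simp: inv_def intro!: bit_size_le_W)
  next
    fix \<rho> assume "inv n \<rho>"
    then show "\<not> bval ?b \<rho> \<and> bwidth ?b \<rho> \<le> W"
      using n_less_B by (auto simp: inv_def intro!: bit_size_le_W)
  qed
  then have "runs (While ?b fsc_body) ?\<sigma> W (\<lambda>t \<tau>.
      1 + (1 + atime (N 1)) + t \<le> n * (n * 50 + 110) + 20 \<and>
      vars \<tau> ''s'' = int (s_min n a (\<lambda>i. {l i..u i})))"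
  proof (rule runs_mono)
    fix t \<tau>
    assume t: "t \<le> n * (1 + btime ?b + (n * 50 + 100)) + (1 + btime ?b) \<and> inv n \<tau>"
    have "1 + (1 + atime (N 1)) + t \<le> n * (n * 50 + 110) + 20"
      using t by (simp add: distrib_left)
    moreover have "vars \<tau> ''s'' = int (s_min n a (\<lambda>i. {l i..u i}))"
      using t by (auto simp: inv_def intro: s_min_eq[symmetric])
    ultimately show "1 + (1 + atime (N 1)) + t \<le> n * (n * 50 + 110) + 20 \<and>
      vars \<tau> ''s'' = int (s_min n a (\<lambda>i. {l i..u i}))" ..
  qed
  moreover have "awidth (N 1) (fsc_input n a l u) \<le> W" using B_pos by (simp add: bit_size_le_W)
  ultimately show ?thesis unfolding fsc_com_def incr_com_def runs_Seq runs_Assign by simp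
qed

end

theorem theorem12:
  shows "\<exists>(c :: com) (T :: nat \<Rightarrow> nat) (P :: nat poly).
    (\<lambda>n. real (T n)) \<in> O(\<lambda>n. real n ^ 3) \<and>
    (\<forall>(n :: nat) (a :: nat \<Rightarrow> int) (l :: nat \<Rightarrow> int) (u :: nat \<Rightarrow> int).
       harmonic_divisors n a \<and> fsc_feasible n a (\<lambda>i. {l i..u i}) \<longrightarrow>
       (\<exists>t w \<tau>. exec c (fsc_input n a l u) t w \<tau> \<and>
          vars \<tau> ''s'' = int (s_min n a (\<lambda>i. {l i..u i})) \<and>
          t \<le> T n \<and>
          w \<le> poly P (fsc_size n a l u)))"
\<comment> \<open>The polynomial is the input size plus 4, which is the width bound
  \<open>W\<close>.\<close>
proof (intro exI[of _ fsc_com] exI[of _ "\<lambda>n. n * (n * 50 + 110) + 20"] exI[of _ "[:4, 1:]"]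
    conjI allI impI)
  \<comment> \<open>For \<open>n \<ge> 1\<close> each monomial is at most \<open>n ^ 3\<close>, and
    180 is the sum of the coefficients 50, 110 and 20.\<close>
  have "real (n * (n * 50 + 110) + 20) \<le> 180 * real n ^ 3" if "n \<ge> 1" for n
  proof -
    have "n ^ 1 \<le> n ^ 3" "n ^ 2 \<le> n ^ 3" "n ^ 0 \<le> n ^ 3"
      using that by (intro power_increasing; simp)+
    then have "n * (n * 50 + 110) + 20 \<le> 180 * n ^ 3"
      by (simp add: algebra_simps power2_eq_square)
    then have "real (n * (n * 50 + 110) + 20) \<le> real (180 * n ^ 3)" by (rule of_nat_mono)
    then show ?thesis by simp
  qed
  then show "(\<lambda>n. real (n * (n * 50 + 110) + 20)) \<in> O(\<lambda>n. real n ^ 3)"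
    by (intro bigoI[of _ 180] eventually_sequentiallyI[of 1]) simp
next
  fix n a l u
  assume "harmonic_divisors n a \<and> fsc_feasible n a (\<lambda>i. {l i..u i})"
  then interpret fsc_instance n a l u by unfold_locales auto
  show "\<exists>t w \<tau>. exec fsc_com (fsc_input n a l u) t w \<tau> \<and>
      vars \<tau> ''s'' = int (s_min n a (\<lambda>i. {l i..u i})) \<and>
      t \<le> n * (n * 50 + 110) + 20 \<and> w \<le> poly [:4, 1:] (fsc_size n a l u)"
    using runs_fsc unfolding runs_def by (auto simp: add.commute)
qed

end
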